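(* Let $X$ be a $\mathrm{CAT}(0)$ space, $C\subseteq X$ a nonempty convex closed subset, $T,U:C\to C$ nonexpansive mappings, $F:=\mathrm{Fix}(T)\cap\mathrm{Fix}(U)$, $u,x_0\in C$ and $(\alpha_n),(\beta_n)\subset[0,1]$. Let $(x_n)$ be generated from $x_0$ by $$x_{2n+1}=(1-\alpha_n)T(x_{2n})\oplus \alpha_n u,\qquad x_{2n+2}=(1-\beta_n)U(x_{2n+1})\oplus\beta_nx_{2n+1}\qquad(n\in\mathbb{N}).$$ Let $N \in \mathbb{N} \setminus \{0\}$ be such that $N \geq \max\{d(x_0,p),d(u,p)\}$ for some $p \in F$. Assume that $\Gamma_1,\Gamma_3,\Gamma_4:(0,+\infty)\to\mathbb{N}$ and $\Gamma_2:\mathbb{N}\to\mathbb{N}$ are monotone functions and $\gamma\in(0,1/2]$ is such that: (Q1) for all $\varepsilon>0$ and all $n\ge\Gamma_1(\varepsilon)$, $\alpha_n\le\varepsilon$; (Q2) for all $k\in\mathbb{N}$, $\sum_{i=0}^{\Gamma_2(k)}\alpha_i\ge k$; (Q3) for all $\varepsilon>0$ and $n\in\mathbb{N}$, $\sum_{i=\Gamma_3(\varepsilon)+1}^{\Gamma_3(\varepsilon)+n}|\alpha_{i+1}-\alpha_i|\le\varepsilon$; (Q4) for all $\varepsilon>0$ and $n\in\mathbb{N}$, $\sum_{i=\Gamma_4(\varepsilon)+1}^{\Gamma_4(\varepsilon)+n}|\beta_{i+1}-\beta_i|\le\varepsilon$; (Q5) $\gamma\le\beta_n\le1-\gamma$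 for all $n\in\mathbb{N}$. Then $$\lim d(x_{n+1},x_n)=\lim d(U(x_n),x_n)=\lim d(T(x_n), x_n)=0,$$ with monotone rates of convergence, respectively, (i) $\rho_1(\varepsilon):=\max\{2\theta_3(\varepsilon)+1, 2\theta_4(\varepsilon)\}$; (ii) $\rho_2(\varepsilon):=2\theta_3\left(\frac{\varepsilon}{3}\right)+2$; (iii) $\rho_3(\varepsilon):=2\max\left\{ \theta_4\left(\frac{\varepsilon}{6}\right), \Gamma_1\left(\frac{\varepsilon}{4N}\right) \right\}+1$, where $\theta_3,\theta_4$ are the functions defined in the context.
   Context: A $\mathrm{CAT}(0)$ space is a metric space $(X,d)$ with a map $W:X\times X\times[0,1]\to X$ such that for all $x,y,z,w\in X$ and $\lambda,\lambda'\in[0,1]$: (W1) $d(z,W(x,y,\lambda))\le(1-\lambda)d(z,x)+\lambda d(z,y)$; (W2) $d(W(x,y,\lambda),W(x,y,\lambda'))=|\lambda-\lambda'|d(x,y)$; (W3) $W(x,y,\lambda)=W(y,x,1-\lambda)$; (W4) $d(W(x,y,\lambda),W(z,w,\lambda))\le(1-\lambda)d(x,z)+\lambda d(y,w)$; and (CN$^-$) $d^2(z,W(x,y,\tfrac12))\le\tfrac12d^2(z,x)+\tfrac12d^2(z,y)-\tfrac14d^2(x,y)$. One writes $(1-\lambda)x\oplus\lambda y:=W(x,y,\lambda)$. A subset $C$ is convex if $(1-\lambda)x\oplus\lambda y\in C$ for all $x,y\in C$, $\lambda\in[0,1]$. $T$ is nonexpansive if $d(T(x),T(y))\le d(x,y)$.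 A rate of convergence for $\lim a_n=0$ is a function $g:(0,+\infty)\to\mathbb{N}$ such that $|a_n|\le\varepsilon$ for all $\varepsilon>0$ and $n\ge g(\varepsilon)$. A function $g:(0,+\infty)\to\mathbb{N}$ is monotone if $\varepsilon\le\varepsilon'$ implies $g(\varepsilon)\ge g(\varepsilon')$; $\Gamma_2:\mathbb{N}\to\mathbb{N}$ is monotone if $k\le k'$ implies $\Gamma_2(k)\le\Gamma_2(k')$. $\lceil x\rceil$ denotes the maximum of $0$ and the usual ceiling of $x$. Definitions (for $\varepsilon>0$): $V(\varepsilon):=\max\{\Gamma_3(\tfrac{\varepsilon}{4N}),\Gamma_4(\tfrac{\varepsilon}{4N})\}$; $\theta_1(\varepsilon):=\Gamma_2\big(V(\tfrac{\varepsilon}{2})+\lceil\ln(\tfrac{4N}{\varepsilon})\rceil+2\big)+1$; $\theta_3(\varepsilon):=\max\{\theta_1(\tfrac{(\gamma\varepsilon)^2}{8N}),\Gamma_1(\tfrac{(\gamma\varepsilon)^2}{2N^2})\}$; $\theta_4(\varepsilon):=\max\{\theta_1(\tfrac\varepsilon2),\theta_3(\tfrac\varepsilon2)\}$. *)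

theory Defs
  imports "HOL-Analysis.Analysis"
begin

text \<open>\<^term>\<open>W x y t\<close> is written \<open>(1 - t) x \<oplus> t y\<close> in the literature: the parameter is the
  weight of the \<^emph>\<open>second\<close> point. \<^term>\<open>W\<close> is only constrained for parameters in \<open>[0,1]\<close>.\<close>

locale CAT0_space =
  fixes W :: "'a::metric_space \<Rightarrow> 'a \<Rightarrow> real \<Rightarrow> 'a"
  assumes W1: "t \<in> {0..1} \<Longrightarrow> dist z (W x y t) \<le> (1 - t) * dist z x + t * dist z y"
    and W2: "\<lbrakk>t \<in> {0..1}; t' \<in> {0..1}\<rbrakk> \<Longrightarrow> dist (W x y t) (W x y t') = \<bar>t - t'\<bar> * dist x y"
    and W3: "t \<in> {0..1} \<Longrightarrow> W x y t = W y x (1 - t)"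
    and W4: "t \<in> {0..1} \<Longrightarrow> dist (W x y t) (W z w t) \<le> (1 - t) * dist x z + t * dist y w"
    and CN: "(dist z (W x y (1/2)))\<^sup>2
              \<le> 1/2 * (dist z x)\<^sup>2 + 1/2 * (dist z y)\<^sup>2 - 1/4 * (dist x y)\<^sup>2"

definition W_convex :: "('a \<Rightarrow> 'a \<Rightarrow> real \<Rightarrow> 'a) \<Rightarrow> 'a set \<Rightarrow> bool" where
  "W_convex W C \<longleftrightarrow> (\<forall>x\<in>C. \<forall>y\<in>C. \<forall>t\<in>{0..1}. W x y t \<in> C)"

definition nonexpansive_on :: "'a::metric_space set \<Rightarrow> ('a \<Rightarrow> 'a) \<Rightarrow> bool" where
  "nonexpansive_on C T \<longleftrightarrow> (\<forall>x\<in>C. \<forall>y\<in>C. dist (T x) (T y) \<le> dist x y)"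

definition Fix_on :: "'a set \<Rightarrow> ('a \<Rightarrow> 'a) \<Rightarrow> 'a set" where
  "Fix_on C T = {x \<in> C. T x = x}"

text \<open>Functions \<open>(0,\<infinity>) \<rightarrow> \<nat>\<close> are total functions on \<^typ>\<open>real\<close> whose values at nonpositive
  arguments are irrelevant. ``Monotone'' for such functions means order-reversing.\<close>

definition monotone_modulus :: "(real \<Rightarrow> nat) \<Rightarrow> bool" where
  "monotone_modulus g \<longleftrightarrow> monotone_on {0<..} (\<le>) (\<ge>) g"

definition rate_of_convergence :: "(nat \<Rightarrow> real) \<Rightarrow> (real \<Rightarrow> nat) \<Rightarrow> bool" where
  "rate_of_convergence a g \<longleftrightarrow> (\<forall>\<epsilon>>0. \<forall>n\<ge>g \<epsilon>. \<bar>a n\<bar> \<le> \<epsilon>)"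

definition V_rate :: "nat \<Rightarrow> (real \<Rightarrow> nat) \<Rightarrow> (real \<Rightarrow> nat) \<Rightarrow> real \<Rightarrow> nat" where
  "V_rate N \<Gamma>\<^sub>3 \<Gamma>\<^sub>4 \<epsilon> = max (\<Gamma>\<^sub>3 (\<epsilon> / (4 * real N))) (\<Gamma>\<^sub>4 (\<epsilon> / (4 * real N)))"

text \<open>Since \<^const>\<open>nat\<close> truncates negative integers, \<^term>\<open>nat \<lceil>x\<rceil>\<close> is the maximum of \<open>0\<close> and the
  ceiling of \<open>x\<close>.\<close>

definition \<theta>\<^sub>1 ::
  "nat \<Rightarrow> (nat \<Rightarrow> nat) \<Rightarrow> (real \<Rightarrow> nat) \<Rightarrow> (real \<Rightarrow> nat) \<Rightarrow> real \<Rightarrow> nat" where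
  "\<theta>\<^sub>1 N \<Gamma>\<^sub>2 \<Gamma>\<^sub>3 \<Gamma>\<^sub>4 \<epsilon> =
     \<Gamma>\<^sub>2 (V_rate N \<Gamma>\<^sub>3 \<Gamma>\<^sub>4 (\<epsilon> / 2) + nat \<lceil>ln (4 * real N / \<epsilon>)\<rceil> + 2) + 1"

definition \<theta>\<^sub>3 ::
  "nat \<Rightarrow> real \<Rightarrow> (real \<Rightarrow> nat) \<Rightarrow> (nat \<Rightarrow> nat) \<Rightarrow> (real \<Rightarrow> nat) \<Rightarrow> (real \<Rightarrow> nat) \<Rightarrow> real \<Rightarrow> nat"
  where
  "\<theta>\<^sub>3 N \<gamma> \<Gamma>\<^sub>1 \<Gamma>\<^sub>2 \<Gamma>\<^sub>3 \<Gamma>\<^sub>4 \<epsilon> =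
     max (\<theta>\<^sub>1 N \<Gamma>\<^sub>2 \<Gamma>\<^sub>3 \<Gamma>\<^sub>4 ((\<gamma> * \<epsilon>)\<^sup>2 / (8 * real N))) (\<Gamma>\<^sub>1 ((\<gamma> * \<epsilon>)\<^sup>2 / (2 * (real N)\<^sup>2)))"

definition \<theta>\<^sub>4 ::
  "nat \<Rightarrow> real \<Rightarrow> (real \<Rightarrow> nat) \<Rightarrow> (nat \<Rightarrow> nat) \<Rightarrow> (real \<Rightarrow> nat) \<Rightarrow> (real \<Rightarrow> nat) \<Rightarrow> real \<Rightarrow> nat"
  where
  "\<theta>\<^sub>4 N \<gamma> \<Gamma>\<^sub>1 \<Gamma>\<^sub>2 \<Gamma>\<^sub>3 \<Gamma>\<^sub>4 \<epsilon> =
     max (\<theta>\<^sub>1 N \<Gamma>\<^sub>2 \<Gamma>\<^sub>3 \<Gamma>\<^sub>4 (\<epsilon> / 2)) (\<theta>\<^sub>3 N \<gamma> \<Gamma>\<^sub>1 \<Gamma>\<^sub>2 \<Gamma>\<^sub>3 \<Gamma>\<^sub>4 (\<epsilon> / 2))"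

definition \<rho>\<^sub>1 ::
  "nat \<Rightarrow> real \<Rightarrow> (real \<Rightarrow> nat) \<Rightarrow> (nat \<Rightarrow> nat) \<Rightarrow> (real \<Rightarrow> nat) \<Rightarrow> (real \<Rightarrow> nat) \<Rightarrow> real \<Rightarrow> nat"
  where
  "\<rho>\<^sub>1 N \<gamma> \<Gamma>\<^sub>1 \<Gamma>\<^sub>2 \<Gamma>\<^sub>3 \<Gamma>\<^sub>4 \<epsilon> =
     max (2 * \<theta>\<^sub>3 N \<gamma> \<Gamma>\<^sub>1 \<Gamma>\<^sub>2 \<Gamma>\<^sub>3 \<Gamma>\<^sub>4 \<epsilon> + 1) (2 * \<theta>\<^sub>4 N \<gamma> \<Gamma>\<^sub>1 \<Gamma>\<^sub>2 \<Gamma>\<^sub>3 \<Gamma>\<^sub>4 \<epsilon>)"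

definition \<rho>\<^sub>2 ::
  "nat \<Rightarrow> real \<Rightarrow> (real \<Rightarrow> nat) \<Rightarrow> (nat \<Rightarrow> nat) \<Rightarrow> (real \<Rightarrow> nat) \<Rightarrow> (real \<Rightarrow> nat) \<Rightarrow> real \<Rightarrow> nat"
  where
  "\<rho>\<^sub>2 N \<gamma> \<Gamma>\<^sub>1 \<Gamma>\<^sub>2 \<Gamma>\<^sub>3 \<Gamma>\<^sub>4 \<epsilon> = 2 * \<theta>\<^sub>3 N \<gamma> \<Gamma>\<^sub>1 \<Gamma>\<^sub>2 \<Gamma>\<^sub>3 \<Gamma>\<^sub>4 (\<epsilon> / 3) + 2"

definition \<rho>\<^sub>3 ::
  "nat \<Rightarrow> real \<Rightarrow> (real \<Rightarrow> nat) \<Rightarrow> (nat \<Rightarrow> nat) \<Rightarrow> (real \<Rightarrow> nat) \<Rightarrow> (real \<Rightarrow> nat) \<Rightarrow> real \<Rightarrow> nat"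
  where
  "\<rho>\<^sub>3 N \<gamma> \<Gamma>\<^sub>1 \<Gamma>\<^sub>2 \<Gamma>\<^sub>3 \<Gamma>\<^sub>4 \<epsilon> =
     2 * max (\<theta>\<^sub>4 N \<gamma> \<Gamma>\<^sub>1 \<Gamma>\<^sub>2 \<Gamma>\<^sub>3 \<Gamma>\<^sub>4 (\<epsilon> / 6)) (\<Gamma>\<^sub>1 (\<epsilon> / (4 * real N))) + 1"

end

theory Submission
  imports Defs
begin

text \<open>The squared \<^term>\<open>CN\<close> inequality is only given for midpoints. It already forces a point
  between \<open>x\<close> and \<open>y\<close> to be determined by its distances to them, so a point at parameter
  \<open>t \<le> 1/2\<close> on a geodesic lies on the half geodesic from \<open>x\<close> to the midpoint. The midpoint
  inequality therefore spreads to every \<open>t\<close>, with a gain of \<open>min t (1 - t) / 2\<close> times the squared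
  distance of the end points; this is weaker than the optimal \<open>t * (1 - t)\<close>, but the rates below
  leave room for it.

  The iteration stays within distance \<open>N\<close> of the common fixed point \<open>p\<close>. By convexity of the
  metric, \<open>a n = d(x (2n+2), x (2n))\<close> satisfies
  \<open>a (n+1) \<le> (1 - \<alpha> (n+1)) * a n + 2N * (\<bar>\<alpha> (n+1) - \<alpha> n\<bar> + \<bar>\<beta> (n+1) - \<beta> n\<bar>)\<close>. The
  increments have small tails, and divergence of \<open>\<Sum>\<alpha>\<close> makes the product of the factors
  \<open>1 - \<alpha> i \<le> exp (- \<alpha> i)\<close> small, so that \<open>a n\<close> vanishes with rate \<open>\<theta>\<^sub>1\<close>.

  Now the Mann step decreases the squared distance to \<open>p\<close> by at least
  \<open>(\<gamma> / 2) * d(U (x (2n+1)), x (2n+1))\<^sup>2\<close>, whereas the Halpern step increases it by at most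
  \<open>\<alpha> n * N\<^sup>2\<close>. As both \<open>a n\<close> and \<open>\<alpha> n\<close> vanish, so does the displacement under \<open>U\<close>, with rate
  \<open>\<theta>\<^sub>3\<close>. Everything else follows from this by the triangle inequality: the displacement under \<open>U\<close>
  bounds \<open>d(x (2n+2), x (2n+1))\<close>, hence with \<open>a n\<close> also \<open>d(x (2n+1), x (2n))\<close>, and \<open>T (x (2n))\<close> is
  within \<open>2N * \<alpha> n\<close> of \<open>x (2n+1)\<close>.\<close>

section \<open>Geodesics in CAT(0) spaces\<close>

context CAT0_space
begin

lemma W_at_0: "W x y 0 = x"
  using W1[of 0 x x y] by simp

lemma W_at_1: "W x y 1 = y"
  using W1[of 1 y x y] by simp

lemma dist_W_left: "t \<in> {0..1} \<Longrightarrow> dist x (W x y t) = t * dist x y"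
  using W2[of 0 t x y] by (simp add: W_at_0)

lemma dist_W_right: "t \<in> {0..1} \<Longrightarrow> dist (W x y t) y = (1 - t) * dist x y"
  using W2[of t 1 x y] by (simp add: W_at_1)

lemma dist_W_W:
  assumes "s \<in> {0..1}" "t \<in> {0..1}"
  shows "dist (W x' y' t) (W x y s) \<le> (1 - t) * dist x' x + t * dist y' y + \<bar>t - s\<bar> * dist x y"
  using dist_triangle[of "W x' y' t" "W x y s" "W x y t"] W4[OF assms(2), of x' y' x y]
    W2[OF assms(2,1), of x y] by simp

text \<open>If \<open>w \<noteq> w'\<close>, then by \<^term>\<open>CN\<close> their midpoint would be strictly closer than the two given
  bounds to both end points, against the triangle inequality.\<close>

lemma between_unique:
  fixes x y w w' :: 'a
  assumes w: "dist x w \<le> s * dist x y" "dist w y \<le> (1 - s) * dist x y"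
    and w': "dist x w' \<le> s * dist x y" "dist w' y \<le> (1 - s) * dist x y"
  shows "w = w'"
proof -
  define q where "q = W w w' (1/2)"
  have sq: "(dist x w)\<^sup>2 \<le> (s * dist x y)\<^sup>2" "(dist w y)\<^sup>2 \<le> ((1 - s) * dist x y)\<^sup>2"
    "(dist x w')\<^sup>2 \<le> (s * dist x y)\<^sup>2" "(dist w' y)\<^sup>2 \<le> ((1 - s) * dist x y)\<^sup>2"
    using assms by (auto intro!: power_mono)
  have xq: "(dist x q)\<^sup>2 \<le> (s * dist x y)\<^sup>2 - 1/4 * (dist w w')\<^sup>2"
    using CN[of x w w'] sq unfolding q_def by linarith
  have qy: "(dist q y)\<^sup>2 \<le> ((1 - s) * dist x y)\<^sup>2 - 1/4 * (dist w w')\<^sup>2"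
    using CN[of y w w'] sq unfolding q_def by (simp add: dist_commute)
  have pos: "0 \<le> s * dist x y" "0 \<le> (1 - s) * dist x y"
    using w zero_le_dist order_trans by blast+
  have "dist q y \<le> (1 - s) * dist x y"
    using order_trans[OF qy, of "((1 - s) * dist x y)\<^sup>2"] by (intro power2_le_imp_le[OF _ pos(2)]) simp
  then have "s * dist x y \<le> dist x q"
    using dist_triangle[of x y q] by (simp add: algebra_simps)
  then have "(s * dist x y)\<^sup>2 \<le> (dist x q)\<^sup>2"
    using pos by (intro power_mono)
  then have "(dist w w')\<^sup>2 \<le> 0"
    using xq by linarith
  then show ?thesis by simp
qed

text \<open>The point at parameter \<open>2 * t\<close> of the half geodesic has the right distance to \<open>x\<close>, and by
  convexity of the metric is close enough to \<open>y\<close>.\<close>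

lemma W_via_midpoint:
  assumes "t \<in> {0..1/2}"
  shows "W x y t = W x (W x y (1/2)) (2 * t)"
proof (rule between_unique[of x _ t y])
  have t: "t \<in> {0..1}" "2 * t \<in> {0..1}" using assms by auto
  show "dist x (W x y t) \<le> t * dist x y" "dist (W x y t) y \<le> (1 - t) * dist x y"
    using t by (simp_all add: dist_W_left dist_W_right)
  show "dist x (W x (W x y (1/2)) (2 * t)) \<le> t * dist x y"
    using t by (simp add: dist_W_left)
  show "dist (W x (W x y (1/2)) (2 * t)) y \<le> (1 - t) * dist x y"
    using W1[OF t(2), of y x "W x y (1/2)"]
    by (simp add: dist_commute[of y] dist_W_right algebra_simps)
qed

lemma W1_squared:
  assumes "t \<in> {0..1}"
  shows "(dist z (W x y t))\<^sup>2 \<le> (1 - t) * (dist z x)\<^sup>2 + t * (dist z y)\<^sup>2"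
proof -
  have "(dist z (W x y t))\<^sup>2 \<le> ((1 - t) * dist z x + t * dist z y)\<^sup>2"
    using W1[OF assms] by (intro power_mono) auto
  also have "\<dots> = (1 - t) * (dist z x)\<^sup>2 + t * (dist z y)\<^sup>2 - t * (1 - t) * (dist z x - dist z y)\<^sup>2"
    by (simp add: power2_eq_square algebra_simps)
  also have "\<dots> \<le> (1 - t) * (dist z x)\<^sup>2 + t * (dist z y)\<^sup>2"
    using assms by simp
  finally show ?thesis .
qed

text \<open>For \<open>t \<le> 1/2\<close> the point is a convex combination of \<open>x\<close> and the midpoint, and only the
  latter, with its weight \<open>2 * t\<close>, contributes the gain \<open>1/4\<close> of \<^term>\<open>CN\<close>.\<close>

lemma CN_weighted_half:
  assumes "t \<in> {0..1/2}"
  shows "(dist z (W x y t))\<^sup>2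
    \<le> (1 - t) * (dist z x)\<^sup>2 + t * (dist z y)\<^sup>2 - t / 2 * (dist x y)\<^sup>2"
proof -
  let ?m = "W x y (1/2)"
  have "(dist z (W x y t))\<^sup>2 \<le> (1 - 2 * t) * (dist z x)\<^sup>2 + 2 * t * (dist z ?m)\<^sup>2"
    using W1_squared[of "2 * t" z x ?m] assms by (simp add: W_via_midpoint[OF assms])
  also have "\<dots> \<le> (1 - 2 * t) * (dist z x)\<^sup>2
      + 2 * t * (1/2 * (dist z x)\<^sup>2 + 1/2 * (dist z y)\<^sup>2 - 1/4 * (dist x y)\<^sup>2)"
    using assms by (intro add_left_mono mult_left_mono CN) auto
  also have "\<dots> = (1 - t) * (dist z x)\<^sup>2 + t * (dist z y)\<^sup>2 - t / 2 * (dist x y)\<^sup>2"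
    by (simp add: algebra_simps)
  finally show ?thesis .
qed

lemma CN_weighted:
  assumes "t \<in> {0..1}"
  shows "(dist z (W x y t))\<^sup>2
    \<le> (1 - t) * (dist z x)\<^sup>2 + t * (dist z y)\<^sup>2 - min t (1 - t) / 2 * (dist x y)\<^sup>2"
proof (cases "t \<le> 1/2")
  case True
  then show ?thesis using CN_weighted_half[of t z x y] assms by (simp add: min_def)
next
  case False
  then show ?thesis
    using CN_weighted_half[of "1 - t" z y x] assms W3[of t x y]
    by (simp add: min_def dist_commute)
qed

end

section \<open>Perturbed contractions with diverging total rate\<close>

text \<open>Unrolling the recursion keeps the product of the factors \<open>1 - \<alpha> i \<le> exp (- \<alpha> i)\<close> in front of
  the initial value, while each perturbation is merely multiplied by later factors, all at most
  \<open>1\<close>.\<close>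

lemma perturbed_contraction_bound:
  fixes s \<alpha> c :: "nat \<Rightarrow> real"
  assumes rec: "\<And>n. s (Suc n) \<le> (1 - \<alpha> (Suc n)) * s n + c n"
    and \<alpha>: "\<And>n. \<alpha> n \<in> {0..1}" and s: "\<And>n. 0 \<le> s n" and c: "\<And>n. 0 \<le> c n"
  shows "s (m + k) \<le> exp (- (\<Sum>i\<in>{m<..m + k}. \<alpha> i)) * s m + (\<Sum>i\<in>{m..<m + k}. c i)"
proof (induction k)
  case (Suc k)
  let ?A = "\<Sum>i\<in>{m<..m + k}. \<alpha> i" and ?S = "\<Sum>i\<in>{m..<m + k}. c i" and ?a = "\<alpha> (Suc (m + k))"
  have a: "0 \<le> 1 - ?a" "1 - ?a \<le> 1" "1 - ?a \<le> exp (- ?a)"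
    using \<alpha>[of "Suc (m + k)"] exp_ge_add_one_self[of "- ?a"] by auto
  have sums: "(\<Sum>i\<in>{m<..m + Suc k}. \<alpha> i) = ?A + ?a" "(\<Sum>i\<in>{m..<m + Suc k}. c i) = ?S + c (m + k)"
    by (simp_all add: atLeastSucAtMost_greaterThanAtMost[symmetric])
  have "s (m + Suc k) \<le> (1 - ?a) * s (m + k) + c (m + k)"
    using rec[of "m + k"] by simp
  also have "\<dots> \<le> (1 - ?a) * (exp (- ?A) * s m + ?S) + c (m + k)"
    using Suc a by (intro add_right_mono mult_left_mono) auto
  also have "\<dots> = (1 - ?a) * (exp (- ?A) * s m) + (1 - ?a) * ?S + c (m + k)"
    by (simp add: distrib_left)
  also have "\<dots> \<le> exp (- ?a) * (exp (- ?A) * s m) + 1 * ?S + c (m + k)"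
    using a s c by (intro add_mono mult_right_mono) (auto intro!: sum_nonneg)
  finally show ?case
    unfolding sums by (simp add: exp_add[symmetric] exp_minus_inverse mult.assoc[symmetric] add.commute)
qed simp

text \<open>Each summand is at most \<open>1\<close>, so the \<open>m + 1\<close> summands up to index \<open>m\<close> contribute at most
  \<open>m + 1\<close>, and no partial sum can reach \<open>m + 1\<close> before the index \<open>m\<close>.\<close>

lemma sum_tail_ge:
  fixes \<alpha> :: "nat \<Rightarrow> real"
  assumes \<alpha>: "\<And>n. \<alpha> n \<in> {0..1}" and div: "real (Suc m + L) \<le> (\<Sum>i\<le>k. \<alpha> i)" and "k \<le> n"
  shows "m \<le> n" and "real L \<le> (\<Sum>i\<in>{m<..n}. \<alpha> i)"
proof -
  have upper: "(\<Sum>i\<le>j. \<alpha> i) \<le> real (Suc j)" for j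
    using sum_bounded_above[of "{..j}" \<alpha> 1] \<alpha> by simp
  show "m \<le> n"
    using order_trans[OF div upper[of k]] \<open>k \<le> n\<close> by simp
  then have "(\<Sum>i\<le>n. \<alpha> i) = (\<Sum>i\<le>m. \<alpha> i) + (\<Sum>i\<in>{m<..n}. \<alpha> i)"
    by (subst sum.union_disjoint[symmetric]) (auto intro!: sum.cong)
  moreover have "(\<Sum>i\<le>k. \<alpha> i) \<le> (\<Sum>i\<le>n. \<alpha> i)"
    using \<alpha> \<open>k \<le> n\<close> by (intro sum_mono2) auto
  ultimately show "real L \<le> (\<Sum>i\<in>{m<..n}. \<alpha> i)"
    using div upper[of m] by simp
qed

lemma tail_sum_le:
  fixes f :: "nat \<Rightarrow> real"
  assumes "\<And>n. (\<Sum>i=g + 1..g + n. f i) \<le> \<epsilon>" and "\<And>n. 0 \<le> f n" and "g < m"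
  shows "(\<Sum>i\<in>{m..<n}. f i) \<le> \<epsilon>"
proof -
  have "(\<Sum>i\<in>{m..<n}. f i) \<le> (\<Sum>i=g + 1..g + n. f i)"
    using assms by (intro sum_mono2) auto
  then show ?thesis using assms(1)[of n] by linarith
qed

section \<open>Monotonicity of the moduli\<close>

lemma monotone_modulusI:
  "(\<And>a b. 0 < a \<Longrightarrow> a \<le> b \<Longrightarrow> g b \<le> g a) \<Longrightarrow> monotone_modulus g"
  by (auto simp: monotone_modulus_def monotone_on_def)

lemma monotone_modulusD:
  "monotone_modulus g \<Longrightarrow> 0 < a \<Longrightarrow> a \<le> b \<Longrightarrow> g b \<le> g a"
  by (auto simp: monotone_modulus_def monotone_on_def)

lemma monotone_modulus_max:
  assumes "monotone_modulus f" "monotone_modulus g"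
  shows "monotone_modulus (\<lambda>\<epsilon>. max (f \<epsilon>) (g \<epsilon>))"
  using assms unfolding monotone_modulus_def monotone_on_def by (fastforce intro: max.mono)

lemma monotone_modulus_compose:
  assumes "monotone_modulus g" and "mono_on {0<..} h" and "\<And>\<epsilon>. 0 < \<epsilon> \<Longrightarrow> 0 < h \<epsilon>"
  shows "monotone_modulus (\<lambda>\<epsilon>. g (h \<epsilon>))"
  using assms by (auto intro!: monotone_modulusI monotone_modulusD[of g] simp: monotone_on_def)

lemma monotone_modulus_divide:
  "monotone_modulus g \<Longrightarrow> 0 < c \<Longrightarrow> monotone_modulus (\<lambda>\<epsilon>. g (\<epsilon> / c))"
  by (rule monotone_modulus_compose) (auto simp: monotone_on_def divide_right_mono)

lemma monotone_modulus_square: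
  assumes "monotone_modulus g" "0 < \<gamma>" "0 < c"
  shows "monotone_modulus (\<lambda>\<epsilon>. g ((\<gamma> * \<epsilon>)\<^sup>2 / c))"
  using assms(2,3)
  by - (rule monotone_modulus_compose[OF assms(1)],
     auto simp: monotone_on_def intro!: divide_right_mono power_mono)

lemma monotone_modulus_affine:
  "monotone_modulus g \<Longrightarrow> monotone_modulus (\<lambda>\<epsilon>. 2 * g \<epsilon> + b)"
  by (auto simp: monotone_modulus_def monotone_on_def)

lemma monotone_modulus_V_rate:
  assumes "N \<noteq> 0" "monotone_modulus \<Gamma>\<^sub>3" "monotone_modulus \<Gamma>\<^sub>4"
  shows "monotone_modulus (V_rate N \<Gamma>\<^sub>3 \<Gamma>\<^sub>4)"
  unfolding V_rate_def[abs_def] using assms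
  by (intro monotone_modulus_max monotone_modulus_divide) auto

lemma monotone_modulus_\<theta>\<^sub>1:
  assumes "N \<noteq> 0" "monotone_modulus \<Gamma>\<^sub>3" "monotone_modulus \<Gamma>\<^sub>4" "mono \<Gamma>\<^sub>2"
  shows "monotone_modulus (\<theta>\<^sub>1 N \<Gamma>\<^sub>2 \<Gamma>\<^sub>3 \<Gamma>\<^sub>4)"
proof (rule monotone_modulusI)
  fix a b :: real assume ab: "0 < a" "a \<le> b"
  have "V_rate N \<Gamma>\<^sub>3 \<Gamma>\<^sub>4 (b / 2) \<le> V_rate N \<Gamma>\<^sub>3 \<Gamma>\<^sub>4 (a / 2)"
    using ab monotone_modulus_V_rate[OF assms(1-3)] by (auto intro: monotone_modulusD)
  moreover have "ln (4 * real N / b) \<le> ln (4 * real N / a)"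
    using ab assms(1) by (auto simp: frac_le intro!: ln_mono)
  then have "nat \<lceil>ln (4 * real N / b)\<rceil> \<le> nat \<lceil>ln (4 * real N / a)\<rceil>"
    by (intro nat_mono ceiling_mono)
  ultimately have "V_rate N \<Gamma>\<^sub>3 \<Gamma>\<^sub>4 (b / 2) + nat \<lceil>ln (4 * real N / b)\<rceil> + 2
      \<le> V_rate N \<Gamma>\<^sub>3 \<Gamma>\<^sub>4 (a / 2) + nat \<lceil>ln (4 * real N / a)\<rceil> + 2"
    by (intro add_mono order_refl)
  then show "\<theta>\<^sub>1 N \<Gamma>\<^sub>2 \<Gamma>\<^sub>3 \<Gamma>\<^sub>4 b \<le> \<theta>\<^sub>1 N \<Gamma>\<^sub>2 \<Gamma>\<^sub>3 \<Gamma>\<^sub>4 a"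
    unfolding \<theta>\<^sub>1_def using monoD[OF assms(4)] by (intro add_right_mono)
qed

lemma rate_of_convergence_imp_tendsto:
  assumes "rate_of_convergence a g"
  shows "a \<longlonglongrightarrow> 0"
proof (rule LIMSEQ_I)
  fix r :: real assume "0 < r"
  then have "\<forall>n\<ge>g (r / 2). \<bar>a n\<bar> \<le> r / 2"
    using assms unfolding rate_of_convergence_def by (metis half_gt_zero)
  then have "\<forall>n\<ge>g (r / 2). norm (a n - 0) < r"
    using \<open>0 < r\<close> by fastforce
  then show "\<exists>no. \<forall>n\<ge>no. norm (a n - 0) < r" by blast
qed

lemma rate_of_convergenceI_parity:
  assumes "\<And>\<epsilon> n. 0 < \<epsilon> \<Longrightarrow> g \<epsilon> \<le> 2 * n \<Longrightarrow> \<bar>a (2 * n)\<bar> \<le> \<epsilon>"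
    and "\<And>\<epsilon> n. 0 < \<epsilon> \<Longrightarrow> g \<epsilon> \<le> 2 * n + 1 \<Longrightarrow> \<bar>a (2 * n + 1)\<bar> \<le> \<epsilon>"
  shows "rate_of_convergence a g"
  unfolding rate_of_convergence_def
proof (intro allI impI)
  fix \<epsilon> :: real and n assume "0 < \<epsilon>" "g \<epsilon> \<le> n"
  then show "\<bar>a n\<bar> \<le> \<epsilon>"
    using assms by (cases "even n") (auto elim!: evenE oddE)
qed

section \<open>The alternating Halpern--Mann iteration\<close>

locale halpern_mann = CAT0_space W
  for W :: "'a::metric_space \<Rightarrow> 'a \<Rightarrow> real \<Rightarrow> 'a" +
  fixes C :: "'a set" and T U :: "'a \<Rightarrow> 'a" and u p :: 'a and x :: "nat \<Rightarrow> 'a"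
    and \<alpha> \<beta> :: "nat \<Rightarrow> real" and K :: real
  assumes convex: "W_convex W C"
    and T: "T \<in> C \<rightarrow> C" "nonexpansive_on C T"
    and U: "U \<in> C \<rightarrow> C" "nonexpansive_on C U"
    and u: "u \<in> C" and x0: "x 0 \<in> C"
    and \<alpha>: "\<And>n. \<alpha> n \<in> {0..1}" and \<beta>: "\<And>n. \<beta> n \<in> {0..1}"
    and odd_step: "\<And>n. x (2 * n + 1) = W (T (x (2 * n))) u (\<alpha> n)"
    and even_step: "\<And>n. x (2 * n + 2) = W (U (x (2 * n + 1))) (x (2 * n + 1)) (\<beta> n)"
    and p: "p \<in> Fix_on C T" "p \<in> Fix_on C U"
    and K: "dist (x 0) p \<le> K" "dist u p \<le> K"
begin

lemma T_le: "a \<in> C \<Longrightarrow> b \<in> C \<Longrightarrow> dist (T a) (T b) \<le> dist a b"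
  using T by (auto simp: nonexpansive_on_def)

lemma U_le: "a \<in> C \<Longrightarrow> b \<in> C \<Longrightarrow> dist (U a) (U b) \<le> dist a b"
  using U by (auto simp: nonexpansive_on_def)

lemma T_fixed_le: "a \<in> C \<Longrightarrow> dist p (T a) \<le> dist p a"
  using T_le[of p a] p by (auto simp: Fix_on_def)

lemma U_fixed_le: "a \<in> C \<Longrightarrow> dist p (U a) \<le> dist p a"
  using U_le[of p a] p by (auto simp: Fix_on_def)

lemma W_in_C: "a \<in> C \<Longrightarrow> b \<in> C \<Longrightarrow> t \<in> {0..1} \<Longrightarrow> W a b t \<in> C"
  using convex by (auto simp: W_convex_def)

lemma W_in_ball:
  assumes "t \<in> {0..1}" "dist p a \<le> K" "dist p b \<le> K"
  shows "dist p (W a b t) \<le> K"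
proof -
  have "dist p (W a b t) \<le> (1 - t) * dist p a + t * dist p b"
    by (rule W1[OF assms(1)])
  also have "\<dots> \<le> (1 - t) * K + t * K"
    using assms by (intro add_mono mult_left_mono) auto
  finally show ?thesis by (simp add: algebra_simps)
qed

lemma odd_step_invariant:
  assumes "x (2 * n) \<in> C \<and> dist p (x (2 * n)) \<le> K"
  shows "x (2 * n + 1) \<in> C \<and> dist p (x (2 * n + 1)) \<le> K"
proof -
  have "dist p (T (x (2 * n))) \<le> K"
    using T_fixed_le[of "x (2 * n)"] assms by linarith
  then show ?thesis
    using assms K(2) T(1) u \<alpha> unfolding odd_step
    by (auto intro!: W_in_ball W_in_C simp: dist_commute)
qed

lemma even_step_invariant:
  assumes "x (2 * n + 1) \<in> C \<and> dist p (x (2 * n + 1)) \<le> K"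
  shows "x (2 * n + 2) \<in> C \<and> dist p (x (2 * n + 2)) \<le> K"
proof -
  have "dist p (U (x (2 * n + 1))) \<le> K"
    using U_fixed_le[of "x (2 * n + 1)"] assms by linarith
  then show ?thesis
    using assms U(1) \<beta> unfolding even_step
    by (auto intro!: W_in_ball W_in_C)
qed

lemma x_invariant: "x n \<in> C \<and> dist p (x n) \<le> K"
proof -
  have even: "x (2 * m) \<in> C \<and> dist p (x (2 * m)) \<le> K" for m
  proof (induction m)
    case 0
    then show ?case using x0 K by (simp add: dist_commute)
  next
    case (Suc m)
    then show ?case using even_step_invariant[OF odd_step_invariant[of m]] by simp
  qed
  show ?thesis
    using even odd_step_invariant[OF even]
    by (cases "even n") (auto elim!: evenE oddE)
qed

lemmas x_in_C = conjunct1[OF x_invariant] and x_bounded = conjunct2[OF x_invariant]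

lemma dist_le_2K: "dist p a \<le> K \<Longrightarrow> dist p b \<le> K \<Longrightarrow> dist a b \<le> 2 * K"
  using dist_triangle[of a b p] by (simp add: dist_commute)

lemma dist_Tx_u: "dist (T (x n)) u \<le> 2 * K"
  using T_fixed_le[OF x_in_C[of n]] x_bounded[of n] K(2)
  by (intro dist_le_2K) (auto simp: dist_commute)

lemma dist_Ux_x: "dist (U (x n)) (x n) \<le> 2 * K"
  using U_fixed_le[OF x_in_C[of n]] x_bounded[of n]
  by (intro dist_le_2K) auto

lemma dist_odd_odd:
  "dist (x (2 * n + 3)) (x (2 * n + 1))
    \<le> (1 - \<alpha> (Suc n)) * dist (x (2 * n + 2)) (x (2 * n)) + 2 * K * \<bar>\<alpha> (Suc n) - \<alpha> n\<bar>"
proof -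
  have "dist (x (2 * n + 3)) (x (2 * n + 1))
      \<le> (1 - \<alpha> (Suc n)) * dist (T (x (2 * n + 2))) (T (x (2 * n)))
        + \<bar>\<alpha> (Suc n) - \<alpha> n\<bar> * dist (T (x (2 * n))) u"
    using odd_step[of "Suc n"] odd_step[of n] \<alpha>
      dist_W_W[of "\<alpha> n" "\<alpha> (Suc n)" "T (x (2 * n + 2))" u "T (x (2 * n))" u]
    by (simp add: numeral_3_eq_3)
  also have "\<dots> \<le> (1 - \<alpha> (Suc n)) * dist (x (2 * n + 2)) (x (2 * n)) + \<bar>\<alpha> (Suc n) - \<alpha> n\<bar> * (2 * K)"
    using \<alpha>[of "Suc n"] by (intro add_mono mult_left_mono T_le x_in_C dist_Tx_u) auto
  finally show ?thesis by (simp add: mult_ac)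
qed

lemma dist_even_even_le:
  "dist (x (2 * n + 4)) (x (2 * n + 2))
    \<le> dist (x (2 * n + 3)) (x (2 * n + 1)) + 2 * K * \<bar>\<beta> (Suc n) - \<beta> n\<bar>"
proof -
  let ?b = "\<beta> (Suc n)" and ?y = "x (2 * n + 3)" and ?z = "x (2 * n + 1)"
  have "dist (x (2 * n + 4)) (x (2 * n + 2))
      \<le> (1 - ?b) * dist (U ?y) (U ?z) + ?b * dist ?y ?z + \<bar>?b - \<beta> n\<bar> * dist (U ?z) ?z"
    using even_step[of "Suc n"] even_step[of n] \<beta>
      dist_W_W[of "\<beta> n" ?b "U ?y" ?y "U ?z" ?z]
    by (simp add: eval_nat_numeral)
  also have "\<dots> \<le> (1 - ?b) * dist ?y ?z + ?b * dist ?y ?z + \<bar>?b - \<beta> n\<bar> * (2 * K)"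
    using \<beta>[of "Suc n"] by (intro add_mono mult_left_mono U_le x_in_C dist_Ux_x order_refl) auto
  finally show ?thesis by (simp add: algebra_simps)
qed

text \<open>The Halpern factor \<open>1 - \<alpha>\<close> survives because the Mann step is nonexpansive up to the
  perturbation of its parameter.\<close>

lemma dist_even_even_rec:
  "dist (x (2 * Suc n + 2)) (x (2 * Suc n))
    \<le> (1 - \<alpha> (Suc n)) * dist (x (2 * n + 2)) (x (2 * n))
      + 2 * K * (\<bar>\<alpha> (Suc n) - \<alpha> n\<bar> + \<bar>\<beta> (Suc n) - \<beta> n\<bar>)"
  using dist_odd_odd[of n] dist_even_even_le[of n] by (simp add: distrib_left numeral_eq_Suc)

lemma dist_even_even_bounded: "dist (x (2 * n + 2)) (x (2 * n)) \<le> 2 * K"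
  by (intro dist_le_2K x_bounded)

text \<open>The quadratic gain of the Mann step is paid for by the drop of the squared distance to
  \<open>p\<close> over two steps, and that drop is at most \<open>2 * K\<close> times the length of the double step.\<close>

lemma displacement_U_squared:
  assumes "\<gamma> \<le> \<beta> n" "\<beta> n \<le> 1 - \<gamma>"
  shows "\<gamma> / 2 * (dist (U (x (2 * n + 1))) (x (2 * n + 1)))\<^sup>2
    \<le> K\<^sup>2 * \<alpha> n + 2 * K * dist (x (2 * n + 2)) (x (2 * n))"
proof -
  let ?a = "dist p (x (2 * n))" and ?b = "dist p (x (2 * n + 1))" and ?c = "dist p (x (2 * n + 2))"
    and ?y = "x (2 * n + 1)"
  have Tp: "dist p (T (x (2 * n))) \<le> ?a" and Up: "dist p (U ?y) \<le> ?b"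
    by (simp_all add: T_fixed_le U_fixed_le x_in_C)
  have "?b\<^sup>2 \<le> (1 - \<alpha> n) * (dist p (T (x (2 * n))))\<^sup>2 + \<alpha> n * (dist p u)\<^sup>2"
    unfolding odd_step by (rule W1_squared[OF \<alpha>])
  also have "\<dots> \<le> 1 * ?a\<^sup>2 + \<alpha> n * K\<^sup>2"
    using \<alpha>[of n] K(2) Tp
    by (intro add_mono mult_mono power_mono) (auto simp: dist_commute)
  finally have halpern: "?b\<^sup>2 \<le> ?a\<^sup>2 + \<alpha> n * K\<^sup>2" by simp
  have "?c\<^sup>2 \<le> (1 - \<beta> n) * (dist p (U ?y))\<^sup>2 + \<beta> n * ?b\<^sup>2
      - min (\<beta> n) (1 - \<beta> n) / 2 * (dist (U ?y) ?y)\<^sup>2"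
    unfolding even_step by (rule CN_weighted[OF \<beta>])
  also have "\<dots> \<le> (1 - \<beta> n) * ?b\<^sup>2 + \<beta> n * ?b\<^sup>2 - \<gamma> / 2 * (dist (U ?y) ?y)\<^sup>2"
    using \<beta>[of n] Up assms by (intro diff_mono add_mono mult_left_mono mult_right_mono power_mono) auto
  finally have mann: "?c\<^sup>2 \<le> ?b\<^sup>2 - \<gamma> / 2 * (dist (U ?y) ?y)\<^sup>2"
    by (simp add: algebra_simps)
  have "?a\<^sup>2 - ?c\<^sup>2 = (?a + ?c) * (?a - ?c)"
    by (simp add: power2_eq_square algebra_simps)
  also have "\<dots> \<le> (?a + ?c) * dist (x (2 * n + 2)) (x (2 * n))"
    using dist_triangle[of p "x (2 * n)" "x (2 * n + 2)"] by (intro mult_left_mono) auto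
  also have "\<dots> \<le> 2 * K * dist (x (2 * n + 2)) (x (2 * n))"
    using x_bounded[of "2 * n"] x_bounded[of "2 * n + 2"] by (intro mult_right_mono) auto
  finally show ?thesis using halpern mann by (simp add: algebra_simps)
qed

lemma dist_even_odd_le: "dist (x (2 * n + 2)) (x (2 * n + 1)) \<le> dist (U (x (2 * n + 1))) (x (2 * n + 1))"
  unfolding even_step dist_W_right[OF \<beta>] using \<beta>[of n] by (intro mult_left_le_one_le) auto

lemma dist_Tx_odd: "dist (T (x (2 * n))) (x (2 * n + 1)) \<le> 2 * K * \<alpha> n"
  unfolding odd_step dist_W_left[OF \<alpha>]
  using mult_left_mono[OF dist_Tx_u, of "\<alpha> n"] \<alpha>[of n] by (simp add: mult_ac)

end

section \<open>Rates of convergence\<close>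

locale halpern_mann_rates = halpern_mann W C T U u p x \<alpha> \<beta> "real N"
  for W :: "'a::metric_space \<Rightarrow> 'a \<Rightarrow> real \<Rightarrow> 'a" and C T U u p x \<alpha> \<beta> and N :: nat +
  fixes \<gamma> :: real and \<Gamma>\<^sub>1 \<Gamma>\<^sub>3 \<Gamma>\<^sub>4 :: "real \<Rightarrow> nat" and \<Gamma>\<^sub>2 :: "nat \<Rightarrow> nat"
  assumes N: "N \<noteq> 0"
    and mono_\<Gamma>: "monotone_modulus \<Gamma>\<^sub>1" "monotone_modulus \<Gamma>\<^sub>3" "monotone_modulus \<Gamma>\<^sub>4" "mono \<Gamma>\<^sub>2"
    and \<gamma>: "\<gamma> \<in> {0<..1/2}"
    and Q1: "\<And>\<epsilon> n. \<epsilon> > 0 \<Longrightarrow> n \<ge> \<Gamma>\<^sub>1 \<epsilon> \<Longrightarrow> \<alpha> n \<le> \<epsilon>"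
    and Q2: "\<And>k. (\<Sum>i=0..\<Gamma>\<^sub>2 k. \<alpha> i) \<ge> real k"
    and Q3: "\<And>\<epsilon> n. \<epsilon> > 0 \<Longrightarrow> (\<Sum>i=\<Gamma>\<^sub>3 \<epsilon> + 1..\<Gamma>\<^sub>3 \<epsilon> + n. \<bar>\<alpha> (i + 1) - \<alpha> i\<bar>) \<le> \<epsilon>"
    and Q4: "\<And>\<epsilon> n. \<epsilon> > 0 \<Longrightarrow> (\<Sum>i=\<Gamma>\<^sub>4 \<epsilon> + 1..\<Gamma>\<^sub>4 \<epsilon> + n. \<bar>\<beta> (i + 1) - \<beta> i\<bar>) \<le> \<epsilon>"
    and Q5: "\<And>n. \<gamma> \<le> \<beta> n \<and> \<beta> n \<le> 1 - \<gamma>"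
begin

abbreviation "th1 \<equiv> \<theta>\<^sub>1 N \<Gamma>\<^sub>2 \<Gamma>\<^sub>3 \<Gamma>\<^sub>4"
abbreviation "th3 \<equiv> \<theta>\<^sub>3 N \<gamma> \<Gamma>\<^sub>1 \<Gamma>\<^sub>2 \<Gamma>\<^sub>3 \<Gamma>\<^sub>4"
abbreviation "th4 \<equiv> \<theta>\<^sub>4 N \<gamma> \<Gamma>\<^sub>1 \<Gamma>\<^sub>2 \<Gamma>\<^sub>3 \<Gamma>\<^sub>4"
abbreviation "r1 \<equiv> \<rho>\<^sub>1 N \<gamma> \<Gamma>\<^sub>1 \<Gamma>\<^sub>2 \<Gamma>\<^sub>3 \<Gamma>\<^sub>4"
abbreviation "r2 \<equiv> \<rho>\<^sub>2 N \<gamma> \<Gamma>\<^sub>1 \<Gamma>\<^sub>2 \<Gamma>\<^sub>3 \<Gamma>\<^sub>4"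
abbreviation "r3 \<equiv> \<rho>\<^sub>3 N \<gamma> \<Gamma>\<^sub>1 \<Gamma>\<^sub>2 \<Gamma>\<^sub>3 \<Gamma>\<^sub>4"

lemma monotone_modulus_\<theta>\<^sub>3: "monotone_modulus th3"
  unfolding \<theta>\<^sub>3_def[abs_def] using N \<gamma>
  by (intro monotone_modulus_max monotone_modulus_square monotone_modulus_\<theta>\<^sub>1 mono_\<Gamma>) auto

lemma monotone_modulus_\<theta>\<^sub>4: "monotone_modulus th4"
  unfolding \<theta>\<^sub>4_def[abs_def] using N
  by (intro monotone_modulus_max monotone_modulus_divide monotone_modulus_\<theta>\<^sub>1
      monotone_modulus_\<theta>\<^sub>3 mono_\<Gamma>) auto

lemma monotone_modulus_\<rho>\<^sub>1: "monotone_modulus r1"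
  unfolding \<rho>\<^sub>1_def[abs_def]
  using monotone_modulus_affine[OF monotone_modulus_\<theta>\<^sub>4, of 0]
  by (intro monotone_modulus_max monotone_modulus_affine monotone_modulus_\<theta>\<^sub>3) simp

lemma monotone_modulus_\<rho>\<^sub>2: "monotone_modulus r2"
  unfolding \<rho>\<^sub>2_def[abs_def]
  by (intro monotone_modulus_affine monotone_modulus_divide monotone_modulus_\<theta>\<^sub>3) simp

lemma monotone_modulus_\<rho>\<^sub>3: "monotone_modulus r3"
  unfolding \<rho>\<^sub>3_def[abs_def] using N
  by (intro monotone_modulus_affine monotone_modulus_max monotone_modulus_divide
      monotone_modulus_\<theta>\<^sub>4 mono_\<Gamma>) auto

text \<open>With \<open>M = V(\<epsilon>/2) + 1\<close>, the perturbations after \<open>M\<close> add up to at most \<open>\<epsilon>/2\<close>, and the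
  contraction factors after \<open>M\<close> reduce the initial bound \<open>2N\<close> to \<open>\<epsilon>/2\<close> as soon as the weights
  \<open>\<alpha>\<close> after \<open>M\<close> add up to \<open>ln (4N/\<epsilon>)\<close>. The weights up to \<open>M\<close> add up to at most \<open>M + 1\<close>, which
  explains the argument of \<open>\<Gamma>\<^sub>2\<close> in \<open>\<theta>\<^sub>1\<close>.\<close>

lemma dist_even_even_rate:
  assumes "0 < \<epsilon>" "th1 \<epsilon> \<le> n"
  shows "dist (x (2 * n + 2)) (x (2 * n)) \<le> \<epsilon>"
proof -
  define M where "M = Suc (V_rate N \<Gamma>\<^sub>3 \<Gamma>\<^sub>4 (\<epsilon> / 2))"
  define L where "L = nat \<lceil>ln (4 * real N / \<epsilon>)\<rceil>"
  define s where "s n = dist (x (2 * n + 2)) (x (2 * n))" for n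
  define c where "c n = 2 * real N * (\<bar>\<alpha> (Suc n) - \<alpha> n\<bar> + \<bar>\<beta> (Suc n) - \<beta> n\<bar>)" for n
  have th1: "\<Gamma>\<^sub>2 (Suc M + L) \<le> n"
    using assms(2) unfolding \<theta>\<^sub>1_def M_def L_def by (simp add: algebra_simps)
  have div: "real (Suc M + L) \<le> (\<Sum>i\<le>\<Gamma>\<^sub>2 (Suc M + L). \<alpha> i)"
    using Q2[of "Suc M + L"] by (simp add: atLeast0AtMost)
  have "M \<le> n" and weights: "real L \<le> (\<Sum>i\<in>{M<..n}. \<alpha> i)"
    using sum_tail_ge[OF \<alpha> div th1] by auto
  have small: "0 < \<epsilon> / (8 * real N)"
    using assms(1) N by simp
  have "(\<Sum>i\<in>{M..<n}. \<bar>\<alpha> (i + 1) - \<alpha> i\<bar>) \<le> \<epsilon> / (8 * real N)"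
    by (rule tail_sum_le[OF Q3[OF small]]) (auto simp: M_def V_rate_def)
  moreover have "(\<Sum>i\<in>{M..<n}. \<bar>\<beta> (i + 1) - \<beta> i\<bar>) \<le> \<epsilon> / (8 * real N)"
    by (rule tail_sum_le[OF Q4[OF small]]) (auto simp: M_def V_rate_def)
  ultimately have "(\<Sum>i\<in>{M..<n}. \<bar>\<alpha> (i + 1) - \<alpha> i\<bar>) + (\<Sum>i\<in>{M..<n}. \<bar>\<beta> (i + 1) - \<beta> i\<bar>)
      \<le> \<epsilon> / (4 * real N)"
    by (simp add: field_simps)
  then have "2 * real N * ((\<Sum>i\<in>{M..<n}. \<bar>\<alpha> (i + 1) - \<alpha> i\<bar>) + (\<Sum>i\<in>{M..<n}. \<bar>\<beta> (i + 1) - \<beta> i\<bar>))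
      \<le> 2 * real N * (\<epsilon> / (4 * real N))"
    by (intro mult_left_mono) auto
  then have perturb: "(\<Sum>i\<in>{M..<n}. c i) \<le> \<epsilon> / 2"
    using N by (simp add: c_def sum_distrib_left[symmetric] sum.distrib)
  have "ln (4 * real N / \<epsilon>) \<le> (\<Sum>i\<in>{M<..n}. \<alpha> i)"
    using weights unfolding L_def by linarith
  then have "exp (- (\<Sum>i\<in>{M<..n}. \<alpha> i)) \<le> exp (- ln (4 * real N / \<epsilon>))"
    by simp
  also have "\<dots> = \<epsilon> / (4 * real N)"
    using assms(1) N by (simp add: exp_minus)
  finally have "exp (- (\<Sum>i\<in>{M<..n}. \<alpha> i)) * s M \<le> \<epsilon> / (4 * real N) * (2 * real N)"
    using dist_even_even_bounded[of M] assms(1) unfolding s_def by (intro mult_mono) auto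
  then have contract: "exp (- (\<Sum>i\<in>{M<..n}. \<alpha> i)) * s M \<le> \<epsilon> / 2"
    using N by simp
  have "s (M + (n - M)) \<le> exp (- (\<Sum>i\<in>{M<..M + (n - M)}. \<alpha> i)) * s M + (\<Sum>i\<in>{M..<M + (n - M)}. c i)"
    using dist_even_even_rec
    by (intro perturbed_contraction_bound \<alpha>) (auto simp: s_def c_def)
  then show ?thesis
    using \<open>M \<le> n\<close> perturb contract unfolding s_def by simp
qed

text \<open>Here \<open>\<gamma> \<le> 1/2\<close> absorbs the factor \<open>\<gamma>/2\<close>: the estimate yields
  \<open>(3/2) * \<gamma> * \<epsilon>\<^sup>2\<close> for the squared displacement.\<close>

lemma displacement_U_odd_rate:
  assumes "0 < \<epsilon>" "th3 \<epsilon> \<le> n"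
  shows "dist (U (x (2 * n + 1))) (x (2 * n + 1)) \<le> \<epsilon>"
proof -
  let ?D = "dist (U (x (2 * n + 1))) (x (2 * n + 1))" and ?e = "(\<gamma> * \<epsilon>)\<^sup>2"
  have pos: "0 < ?e / (8 * real N)" "0 < ?e / (2 * (real N)\<^sup>2)"
    using assms(1) \<gamma> N by auto
  have "dist (x (2 * n + 2)) (x (2 * n)) \<le> ?e / (8 * real N)"
    using assms(2) by (intro dist_even_even_rate pos) (simp add: \<theta>\<^sub>3_def)
  then have "2 * real N * dist (x (2 * n + 2)) (x (2 * n)) \<le> 2 * real N * (?e / (8 * real N))"
    by (intro mult_left_mono) auto
  moreover have "\<alpha> n \<le> ?e / (2 * (real N)\<^sup>2)"
    using assms(2) by (intro Q1 pos) (simp add: \<theta>\<^sub>3_def)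
  then have "(real N)\<^sup>2 * \<alpha> n \<le> (real N)\<^sup>2 * (?e / (2 * (real N)\<^sup>2))"
    by (intro mult_left_mono) auto
  ultimately have "\<gamma> / 2 * ?D\<^sup>2 \<le> ?e / 2 + ?e / 4"
    using displacement_U_squared[of \<gamma> n] Q5[of n] N by simp
  also have "\<dots> = \<gamma> / 2 * (3/2 * \<gamma> * \<epsilon>\<^sup>2)"
    by (simp add: power2_eq_square)
  finally have "?D\<^sup>2 \<le> 3/2 * \<gamma> * \<epsilon>\<^sup>2"
    using \<gamma> by simp
  also have "\<dots> \<le> 1 * \<epsilon>\<^sup>2"
    using \<gamma> by (intro mult_right_mono) auto
  finally show ?thesis
    using assms(1) by (intro power2_le_imp_le[of ?D \<epsilon>]) simp_all
qed

lemma dist_odd_rate: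
  assumes "0 < \<epsilon>" "th3 \<epsilon> \<le> n"
  shows "dist (x (2 * n + 2)) (x (2 * n + 1)) \<le> \<epsilon>"
  using dist_even_odd_le[of n] displacement_U_odd_rate[OF assms] by linarith

lemma dist_even_rate:
  assumes "0 < \<epsilon>" "th4 \<epsilon> \<le> n"
  shows "dist (x (2 * n + 1)) (x (2 * n)) \<le> \<epsilon>"
proof -
  have "dist (x (2 * n + 2)) (x (2 * n + 1)) \<le> \<epsilon> / 2" "dist (x (2 * n + 2)) (x (2 * n)) \<le> \<epsilon> / 2"
    using assms by (intro dist_odd_rate dist_even_even_rate; simp add: \<theta>\<^sub>4_def)+
  then show ?thesis
    using dist_triangle3[of "x (2 * n + 1)" "x (2 * n)" "x (2 * n + 2)"] by simp
qed

lemma rate_asymptotic_regularity: "rate_of_convergence (\<lambda>n. dist (x (n + 1)) (x n)) r1"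
proof (rule rate_of_convergenceI_parity)
  fix \<epsilon> :: real and n assume "0 < \<epsilon>" "r1 \<epsilon> \<le> 2 * n"
  then show "\<bar>dist (x (2 * n + 1)) (x (2 * n))\<bar> \<le> \<epsilon>"
    using dist_even_rate[of \<epsilon> n] by (simp add: \<rho>\<^sub>1_def)
next
  fix \<epsilon> :: real and n assume "0 < \<epsilon>" "r1 \<epsilon> \<le> 2 * n + 1"
  then show "\<bar>dist (x (2 * n + 1 + 1)) (x (2 * n + 1))\<bar> \<le> \<epsilon>"
    using dist_odd_rate[of \<epsilon> n] by (simp add: \<rho>\<^sub>1_def)
qed

lemma rate_displacement_U: "rate_of_convergence (\<lambda>n. dist (U (x n)) (x n)) r2"
proof (rule rate_of_convergenceI_parity)
  fix \<epsilon> :: real and n assume \<epsilon>: "0 < \<epsilon>" and "r2 \<epsilon> \<le> 2 * n"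
  then obtain m where m: "n = Suc m" "th3 (\<epsilon> / 3) \<le> m"
    unfolding \<rho>\<^sub>2_def by (cases n) auto
  let ?y = "x (2 * m + 1)" and ?z = "x (2 * m + 2)"
  have "dist (U ?y) ?y \<le> \<epsilon> / 3" "dist ?z ?y \<le> \<epsilon> / 3"
    using \<epsilon> m by (intro displacement_U_odd_rate dist_odd_rate; simp)+
  moreover have "dist (U ?z) (U ?y) \<le> dist ?z ?y"
    by (intro U_le x_in_C)
  moreover have "dist (U ?z) ?z \<le> dist (U ?z) (U ?y) + dist (U ?y) ?y + dist ?z ?y"
    using dist_triangle[of "U ?z" ?z "U ?y"] dist_triangle[of "U ?y" ?z ?y] dist_commute[of ?y ?z]
    by linarith
  ultimately have "dist (U ?z) ?z \<le> \<epsilon>"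
    by linarith
  then show "\<bar>dist (U (x (2 * n))) (x (2 * n))\<bar> \<le> \<epsilon>"
    using m(1) by simp
next
  fix \<epsilon> :: real and n assume \<epsilon>: "0 < \<epsilon>" and n: "r2 \<epsilon> \<le> 2 * n + 1"
  have "dist (U (x (2 * n + 1))) (x (2 * n + 1)) \<le> \<epsilon> / 3"
    using \<epsilon> n by (intro displacement_U_odd_rate) (auto simp: \<rho>\<^sub>2_def)
  then show "\<bar>dist (U (x (2 * n + 1))) (x (2 * n + 1))\<bar> \<le> \<epsilon>"
    using \<epsilon> by simp
qed

text \<open>These two distances suffice at both parities: \<open>T (x (2n))\<close> reaches \<open>x (2n)\<close> through
  \<open>x (2n+1)\<close>, and \<open>T (x (2n+1))\<close> reaches \<open>x (2n+1)\<close> through \<open>T (x (2n))\<close>.\<close>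

lemma displacement_T_pieces:
  assumes "0 < \<epsilon>" "r3 \<epsilon> \<le> 2 * n + 1"
  shows "dist (T (x (2 * n))) (x (2 * n + 1)) \<le> \<epsilon> / 2"
    and "dist (x (2 * n + 1)) (x (2 * n)) \<le> \<epsilon> / 6"
proof -
  have n: "th4 (\<epsilon> / 6) \<le> n" "\<Gamma>\<^sub>1 (\<epsilon> / (4 * real N)) \<le> n"
    using assms(2) unfolding \<rho>\<^sub>3_def by auto
  then show "dist (x (2 * n + 1)) (x (2 * n)) \<le> \<epsilon> / 6"
    using assms(1) by (intro dist_even_rate) auto
  have "\<alpha> n \<le> \<epsilon> / (4 * real N)"
    using assms(1) n N by (intro Q1) auto
  then have "2 * real N * \<alpha> n \<le> 2 * real N * (\<epsilon> / (4 * real N))"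
    by (intro mult_left_mono) auto
  then show "dist (T (x (2 * n))) (x (2 * n + 1)) \<le> \<epsilon> / 2"
    using dist_Tx_odd[of n] N by simp
qed

lemma rate_displacement_T: "rate_of_convergence (\<lambda>n. dist (T (x n)) (x n)) r3"
proof (rule rate_of_convergenceI_parity)
  fix \<epsilon> :: real and n assume "0 < \<epsilon>" "r3 \<epsilon> \<le> 2 * n"
  then show "\<bar>dist (T (x (2 * n))) (x (2 * n))\<bar> \<le> \<epsilon>"
    using displacement_T_pieces[of \<epsilon> n]
      dist_triangle[of "T (x (2 * n))" "x (2 * n)" "x (2 * n + 1)"] by simp
next
  fix \<epsilon> :: real and n assume "0 < \<epsilon>" "r3 \<epsilon> \<le> 2 * n + 1"
  moreover have "dist (T (x (2 * n + 1))) (T (x (2 * n))) \<le> dist (x (2 * n + 1)) (x (2 * n))"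
    by (intro T_le x_in_C)
  ultimately show "\<bar>dist (T (x (2 * n + 1))) (x (2 * n + 1))\<bar> \<le> \<epsilon>"
    using displacement_T_pieces[of \<epsilon> n]
      dist_triangle[of "T (x (2 * n + 1))" "x (2 * n + 1)" "T (x (2 * n))"] by simp
qed

end

theorem proposition3p6:
  fixes W :: "'a::metric_space \<Rightarrow> 'a \<Rightarrow> real \<Rightarrow> 'a"
    and C :: "'a set" and T U :: "'a \<Rightarrow> 'a" and u :: 'a and x :: "nat \<Rightarrow> 'a"
    and \<alpha> \<beta> :: "nat \<Rightarrow> real" and N :: nat and \<gamma> :: real
    and \<Gamma>\<^sub>1 \<Gamma>\<^sub>3 \<Gamma>\<^sub>4 :: "real \<Rightarrow> nat" and \<Gamma>\<^sub>2 :: "nat \<Rightarrow> nat"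
  assumes "CAT0_space W"
    and "C \<noteq> {}" and "W_convex W C" and "closed C"
    and "T \<in> C \<rightarrow> C" and "nonexpansive_on C T"
    and "U \<in> C \<rightarrow> C" and "nonexpansive_on C U"
    and "u \<in> C" and "x 0 \<in> C"
    and "\<And>n. \<alpha> n \<in> {0..1}" and "\<And>n. \<beta> n \<in> {0..1}"
    and "\<And>n. x (2 * n + 1) = W (T (x (2 * n))) u (\<alpha> n)"
    and "\<And>n. x (2 * n + 2) = W (U (x (2 * n + 1))) (x (2 * n + 1)) (\<beta> n)"
    and "N \<noteq> 0"
    and "\<exists>p \<in> Fix_on C T \<inter> Fix_on C U. real N \<ge> max (dist (x 0) p) (dist u p)"
    and "monotone_modulus \<Gamma>\<^sub>1" and "monotone_modulus \<Gamma>\<^sub>3" and "monotone_modulus \<Gamma>\<^sub>4"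
    and "mono \<Gamma>\<^sub>2"
    and "\<gamma> \<in> {0<..1/2}"
    and Q1: "\<And>\<epsilon> n. \<epsilon> > 0 \<Longrightarrow> n \<ge> \<Gamma>\<^sub>1 \<epsilon> \<Longrightarrow> \<alpha> n \<le> \<epsilon>"
    and Q2: "\<And>k. (\<Sum>i=0..\<Gamma>\<^sub>2 k. \<alpha> i) \<ge> real k"
    and Q3: "\<And>\<epsilon> n. \<epsilon> > 0 \<Longrightarrow> (\<Sum>i=\<Gamma>\<^sub>3 \<epsilon> + 1..\<Gamma>\<^sub>3 \<epsilon> + n. \<bar>\<alpha> (i + 1) - \<alpha> i\<bar>) \<le> \<epsilon>"
    and Q4: "\<And>\<epsilon> n. \<epsilon> > 0 \<Longrightarrow> (\<Sum>i=\<Gamma>\<^sub>4 \<epsilon> + 1..\<Gamma>\<^sub>4 \<epsilon> + n. \<bar>\<beta> (i + 1) - \<beta> i\<bar>) \<le> \<epsilon>"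
    and Q5: "\<And>n. \<gamma> \<le> \<beta> n \<and> \<beta> n \<le> 1 - \<gamma>"
  shows "((\<lambda>n. dist (x (n + 1)) (x n)) \<longlonglongrightarrow> 0 \<and>
          (\<lambda>n. dist (U (x n)) (x n)) \<longlonglongrightarrow> 0 \<and>
          (\<lambda>n. dist (T (x n)) (x n)) \<longlonglongrightarrow> 0) \<and>
         (rate_of_convergence (\<lambda>n. dist (x (n + 1)) (x n)) (\<rho>\<^sub>1 N \<gamma> \<Gamma>\<^sub>1 \<Gamma>\<^sub>2 \<Gamma>\<^sub>3 \<Gamma>\<^sub>4) \<and>
          monotone_modulus (\<rho>\<^sub>1 N \<gamma> \<Gamma>\<^sub>1 \<Gamma>\<^sub>2 \<Gamma>\<^sub>3 \<Gamma>\<^sub>4)) \<and>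
         (rate_of_convergence (\<lambda>n. dist (U (x n)) (x n)) (\<rho>\<^sub>2 N \<gamma> \<Gamma>\<^sub>1 \<Gamma>\<^sub>2 \<Gamma>\<^sub>3 \<Gamma>\<^sub>4) \<and>
          monotone_modulus (\<rho>\<^sub>2 N \<gamma> \<Gamma>\<^sub>1 \<Gamma>\<^sub>2 \<Gamma>\<^sub>3 \<Gamma>\<^sub>4)) \<and>
         (rate_of_convergence (\<lambda>n. dist (T (x n)) (x n)) (\<rho>\<^sub>3 N \<gamma> \<Gamma>\<^sub>1 \<Gamma>\<^sub>2 \<Gamma>\<^sub>3 \<Gamma>\<^sub>4) \<and>
          monotone_modulus (\<rho>\<^sub>3 N \<gamma> \<Gamma>\<^sub>1 \<Gamma>\<^sub>2 \<Gamma>\<^sub>3 \<Gamma>\<^sub>4))"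
proof -
  obtain p where p: "p \<in> Fix_on C T" "p \<in> Fix_on C U" "dist (x 0) p \<le> real N" "dist u p \<le> real N"
    using assms(16) by auto
  interpret CAT0_space W by fact
  interpret halpern_mann_rates W C T U u p x \<alpha> \<beta> N \<gamma> \<Gamma>\<^sub>1 \<Gamma>\<^sub>3 \<Gamma>\<^sub>4 \<Gamma>\<^sub>2
    by unfold_locales (fact | fact p)+
  show ?thesis
    using rate_asymptotic_regularity rate_displacement_U rate_displacement_T
      monotone_modulus_\<rho>\<^sub>1 monotone_modulus_\<rho>\<^sub>2 monotone_modulus_\<rho>\<^sub>3
    by (simp add: rate_of_convergence_imp_tendsto)
qed

end
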